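(* Let $T$ be an $n$-vertex tree and let $\mathbf{s}=(s_1,\dots,s_n)\in\mathbb{Z}_{\ge 0}^n$ be a chip configuration on $T$. Then $\mathbf{s}$ is self-reachable on $T$ if and only if, for every $m$ and every $m$-vertex subtree $T^*$ of $T$, $\mathbf{s}$ has at least $m-1$ chips on $T^*$, i.e. $\sum_{v_i\in V(T^* )} s_i\ge m-1$.
   Context: All graphs are finite and simple with at least one vertex; the vertices of an $n$-vertex graph are labelled $v_1,\dots,v_n$. A subtree of $T$ is a connected subgraph of $T$ with at least one vertex. A chip configuration on an $n$-vertex graph $G$ is a vector $\mathbf{c}\in\mathbb{Z}_{\ge 0}^n$, where $c_i$ is the number of chips on $v_i$. The Laplacian $\Delta(G)$ is the $n\times n$ matrix with $\Delta_{ii}=\deg(v_i)$, $\Delta_{ij}=-1$ if $i\ne j$ and $v_i,v_j$ are adjacent, and $\Delta_{ij}=0$ otherwise. Firing $v_i$ from $\mathbf{c}$ yields $\mathbf{c}-\Delta(G)\mathbf{e}_i$ (with $\mathbf{e}_i$ the $i$th standard basis vector); this is legal if $c_i\ge\deg(v_i)$, equivalently if the result is again a chip configuration (so firing a vertex of degree $0$ is always legal and changes nothing). A firing sequence is a finite sequence of vertex indices; it is legal on $G$ starting from $\mathbf{c}$ if, performing the firings in order starting from $\mathbf{c}$, each one is legal from the configuration reached so far. $R^{(G)}(\mathbf{c})$ denotes the set of chip configurations that can be reached from $\mathbf{c}$ by nonempty legal firing sequences on $G$. A chip configuration $\mathbf{s}$ on a connected graph $G$ is self-reachable on $G$ if $\mathbf{s}\in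 R^{(G)}(\mathbf{s})$. *)

theory Defs
  imports "Jordan_Normal_Form.Matrix" "Graph_Theory.Graph_Theory"
begin

text \<open>
  A finite simple graph is a \<^locale>\<open>pair_graph\<close>: every edge \<open>{u, v}\<close> is represented by
  the two arcs \<open>(u, v)\<close> and \<open>(v, u)\<close>.  Accordingly the degree of a vertex is its
  \<^const>\<open>out_degree\<close>.  The vertices \<open>v\<^sub>1, \<dots>, v\<^sub>n\<close> of an \<open>n\<close>-vertex graph are
  numbered \<open>0, \<dots>, n - 1\<close>, as are the entries of vectors and matrices.
\<close>

definition vertex_graph :: "nat \<Rightarrow> nat pair_pre_digraph \<Rightarrow> bool" where
  "vertex_graph n G \<longleftrightarrow> pair_graph G \<and> n \<ge> 1 \<and> pverts G = {0..<n}"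

text \<open>
  The library predicate \<^const>\<open>Digraph_Component.tree\<close> does not fit this encoding: there,
  going back and forth along an edge is a cycle of length 2.  A cycle of the undirected graph
  is a directed cycle of length at least 3.
\<close>

definition undirected_tree :: "'a pair_pre_digraph \<Rightarrow> bool" where
  "undirected_tree T \<longleftrightarrow> pair_graph T \<and> Digraph_Component.connected (with_proj T) \<and>
     \<not> (\<exists>p. pre_digraph.cycle (with_proj T) p \<and> length p \<ge> 3)"

text \<open>\<^const>\<open>Digraph_Component.connected\<close> includes that there is at least one vertex.
  The condition \<^term>\<open>pair_graph H\<close> says that \<open>H\<close> contains both or neither of
  the arcs representing an edge.\<close>

definition subtree :: "'a pair_pre_digraph \<Rightarrow> 'a pair_pre_digraph \<Rightarrow> bool" where
  "subtree H T \<longleftrightarrow> pair_graph H \<and> subgraph (with_proj H) (with_proj T) \<and>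
     Digraph_Component.connected (with_proj H)"

abbreviation deg :: "'a pair_pre_digraph \<Rightarrow> 'a \<Rightarrow> nat" where
  "deg G v \<equiv> out_degree (with_proj G) v"

definition laplacian :: "nat pair_pre_digraph \<Rightarrow> int mat" where
  "laplacian G = mat (card (pverts G)) (card (pverts G))
     (\<lambda>(i, j). if i = j then int (deg G i) else if (i, j) \<in> parcs G then - 1 else 0)"

definition chip_config :: "nat pair_pre_digraph \<Rightarrow> int vec \<Rightarrow> bool" where
  "chip_config G c \<longleftrightarrow>
     c \<in> carrier_vec (card (pverts G)) \<and> (\<forall>i < card (pverts G). c $ i \<ge> 0)"

definition fire :: "nat pair_pre_digraph \<Rightarrow> int vec \<Rightarrow> nat \<Rightarrow> int vec" where
  "fire G c i = c - laplacian G *\<^sub>v unit_vec (card (pverts G)) i"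

fun legal :: "nat pair_pre_digraph \<Rightarrow> int vec \<Rightarrow> nat list \<Rightarrow> bool" where
  "legal G c [] \<longleftrightarrow> True"
| "legal G c (i # w) \<longleftrightarrow> i \<in> pverts G \<and> c $ i \<ge> int (deg G i) \<and> legal G (fire G c i) w"

definition reachable_configs :: "nat pair_pre_digraph \<Rightarrow> int vec \<Rightarrow> int vec set" where
  "reachable_configs G c = {foldl (fire G) c w | w. w \<noteq> [] \<and> legal G c w}"

definition self_reachable :: "nat pair_pre_digraph \<Rightarrow> int vec \<Rightarrow> bool" where
  "self_reachable G s \<longleftrightarrow> s \<in> reachable_configs G s"

end

theory Submission
  imports Defs
begin

text \<open>
  Suppose a nonempty legal firing sequence leads from \<open>s\<close> back to \<open>s\<close>.  Every vertex fires in
  it: firing a vertex never removes chips from a set it does not belong to, and it adds chips to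
  such a set if it has a neighbour there.  So if some vertices never fired, the chips on them would
  have increased, because some fired vertex is adjacent to one of them
  (\<open>self_reaching_fires_all\<close>).  After any legal sequence, every set \<open>A\<close> of fired vertices
  carries at least as many chips as there are edges inside \<open>A\<close> (\<open>legal_chips_ge_edges\<close>): if
  \<open>x \<in> A\<close> fires, each of its edges inside \<open>A\<close> receives a chip at its other end, and
  \<open>x\<close> itself does not go into debt.  An \<open>m\<close>-vertex subtree has at least \<open>m - 1\<close> edges, which
  gives one direction.

  Conversely, firing every vertex exactly once changes nothing, since each edge carries one chip
  in either direction.  If the vertices are fired in some order, then the vertex \<open>v\<close> can fire when
  its turn comes as soon as \<open>s\<close> has at least as many chips on \<open>v\<close> as \<open>v\<close> has neighbours that
  fire later, because every earlier neighbour has already sent a chip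
  (\<open>firing_order_self_reachable\<close>).  Such an order is built by removing leaves
  (\<open>firing_order_exists\<close>).  A leaf with a chip is fired first.  A leaf without chips is fired
  last, and its neighbour \<open>p\<close> has to spend one chip on it; the inequality for a subtree through
  \<open>p\<close> survives this, because before the removal it also held for the subtree extended by the
  leaf.
\<close>

section \<open>Connected vertex sets and edge counts\<close>

definition deg_in :: "'a rel \<Rightarrow> 'a set \<Rightarrow> 'a \<Rightarrow> nat" where
  "deg_in R A x = card {y \<in> A. (x, y) \<in> R}"

text \<open>
  For a symmetric relation these are the finite, nonempty vertex sets that induce a connected
  subgraph.  Growing them vertex by vertex is what makes both the edge count and the extension by
  a leaf immediate.
\<close>

inductive connected_set :: "'a rel \<Rightarrow> 'a set \<Rightarrow> bool" for R where
  singleton: "connected_set R {x}"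
| insert: "connected_set R C \<Longrightarrow> x \<in> C \<Longrightarrow> (x, y) \<in> R \<Longrightarrow> y \<notin> C \<Longrightarrow> connected_set R (insert y C)"

lemma connected_set_finite: "connected_set R C \<Longrightarrow> finite C"
  by (induction rule: connected_set.induct) auto

lemma connected_set_nonempty: "connected_set R C \<Longrightarrow> C \<noteq> {}"
  by (induction rule: connected_set.induct) auto

text \<open>A maximal connected subset of \<open>V\<close> can only be \<open>V\<close> itself, as any arc leaving it within
  \<open>V\<close> would extend it.\<close>

lemma connected_set_if_no_cut:
  assumes "finite V" "V \<noteq> {}"
    and cut: "\<And>C. C \<subset> V \<Longrightarrow> C \<noteq> {} \<Longrightarrow> \<exists>x\<in>C. \<exists>y\<in>V - C. (x, y) \<in> R"
  shows "connected_set R V"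
proof -
  let ?S = "{C. C \<subseteq> V \<and> connected_set R C}"
  obtain v where "v \<in> V" using \<open>V \<noteq> {}\<close> by blast
  then have "{v} \<in> ?S" by (auto intro: connected_set.singleton)
  moreover have "finite ?S" using \<open>finite V\<close> by simp
  ultimately have "\<exists>C\<in>?S. \<forall>D\<in>?S. C \<subseteq> D \<longrightarrow> C = D"
    using finite_has_maximal[of ?S] by blast
  then obtain C where C: "C \<subseteq> V" "connected_set R C"
    and max: "\<forall>D\<in>?S. C \<subseteq> D \<longrightarrow> C = D" by auto
  have "C = V"
  proof (rule ccontr)
    assume "C \<noteq> V"
    with C cut[of C] obtain x y where xy: "x \<in> C" "y \<in> V - C" "(x, y) \<in> R"
      using connected_set_nonempty[OF C(2)] by auto
    then have "insert y C \<in> ?S" using C by (auto intro: connected_set.insert)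
    with max have "C = insert y C" by blast
    with xy(2) show False by blast
  qed
  with C show ?thesis by simp
qed

lemma deg_in_insert:
  assumes "finite A" "y \<notin> A"
  shows "deg_in R (insert y A) x = deg_in R A x + (if (x, y) \<in> R then 1 else 0)"
proof -
  have "{z \<in> insert y A. (x, z) \<in> R} = (if (x, y) \<in> R then {y} else {}) \<union> {z \<in> A. (x, z) \<in> R}"
    by auto
  with assms show ?thesis by (auto simp: deg_in_def)
qed

lemma deg_in_disjoint_union:
  assumes "finite A" "finite B" "A \<inter> B = {}"
  shows "deg_in R (A \<union> B) x = deg_in R A x + deg_in R B x"
proof -
  have "{y \<in> A \<union> B. (x, y) \<in> R} = {y \<in> A. (x, y) \<in> R} \<union> {y \<in> B. (x, y) \<in> R}" by auto
  then show ?thesis using assms by (auto simp: deg_in_def intro: card_Un_disjoint)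
qed

lemma deg_in_sum:
  assumes "finite A" "sym R"
  shows "deg_in R A x = (\<Sum>y\<in>A. if (y, x) \<in> R then 1 else 0)"
  using assms by (auto simp: deg_in_def sum.If_cases Int_def dest: symD intro: arg_cong[where f = card])

lemma sum_deg_in_insert:
  assumes "finite A" "y \<notin> A" "sym R" "(y, y) \<notin> R"
  shows "(\<Sum>x\<in>insert y A. deg_in R (insert y A) x) = (\<Sum>x\<in>A. deg_in R A x) + 2 * deg_in R A y"
  using assms deg_in_sum[of A R y] by (simp add: deg_in_insert sum.distrib)

text \<open>
  The degree sum counts each edge inside \<open>C\<close> twice, so this is the bound of \<open>card C - 1\<close> on
  the number of edges: every vertex added to a connected set brings an edge with it.
\<close>

lemma connected_set_sum_deg_in:
  assumes "connected_set R C" "sym R" "irrefl R"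
  shows "2 * card C \<le> (\<Sum>x\<in>C. deg_in R C x) + 2"
  using assms(1)
proof induction
  case (singleton x)
  then show ?case by simp
next
  case (insert C x y)
  have fin: "finite C" using insert connected_set_finite by blast
  have "(y, x) \<in> R" using insert assms by (auto dest: symD)
  then have "card {z \<in> C. (y, z) \<in> R} > 0"
    using fin insert by (auto simp: card_gt_0_iff)
  then have "deg_in R C y \<ge> 1" by (simp add: deg_in_def)
  moreover have "(y, y) \<notin> R" using assms by (auto simp: irrefl_def)
  ultimately show ?case
    using insert fin assms by (simp add: sum_deg_in_insert del: sum.insert)
qed

section \<open>Leaves of forests\<close>

text \<open>
  All neighbours of the first vertex \<open>x\<close> of a longest path lie on that path.  One of them is not
  the second vertex, and the path up to that neighbour closes to a cycle through at least three
  vertices.  The cycle is given by the vertices \<open>zs\<close> visited after the start \<open>x\<close>, which is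
  therefore also the last entry of \<open>zs\<close>.
\<close>

lemma min_degree_two_imp_cycle:
  assumes "finite A" "A \<noteq> {}" "sym R" "irrefl R"
    and deg: "\<And>x. x \<in> A \<Longrightarrow> deg_in R A x \<ge> 2"
  shows "\<exists>x zs. length zs \<ge> 3 \<and> distinct zs \<and> last zs = x \<and> successively (\<lambda>x y. (x, y) \<in> R) (x # zs)"
proof -
  have nbr: "card {y \<in> A. (x, y) \<in> R} \<ge> 2" if "x \<in> A" for x
    using deg[OF that] by (simp add: deg_in_def)
  define P where "P xs \<longleftrightarrow> xs \<noteq> [] \<and> distinct xs \<and> set xs \<subseteq> A \<and> successively (\<lambda>x y. (x, y) \<in> R) xs"
    for xs
  obtain a where "a \<in> A" using \<open>A \<noteq> {}\<close> by blast
  then have "P [a]" by (simp add: P_def)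
  moreover have "\<forall>xs. P xs \<longrightarrow> length xs \<le> card A"
    using \<open>finite A\<close> by (auto simp: P_def distinct_card[symmetric] card_mono)
  ultimately obtain xs where xs: "P xs" and max: "\<And>ys. P ys \<Longrightarrow> length ys \<le> length xs"
    using ex_has_greatest_nat[of P "[a]" length "Suc (card A)"] by (auto simp: less_Suc_eq_le)
  obtain x ys where xs_eq: "xs = x # ys" using xs by (cases xs) (auto simp: P_def)
  have x: "x \<in> A" using xs by (simp add: P_def xs_eq)
  have nbrs_on_path: "{y \<in> A. (x, y) \<in> R} \<subseteq> set ys"
  proof
    fix z assume z: "z \<in> {y \<in> A. (x, y) \<in> R}"
    show "z \<in> set ys"
    proof (rule ccontr)
      assume "z \<notin> set ys"
      with z assms(3,4) xs have "P (z # xs)"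
        by (auto simp: P_def xs_eq irrefl_def dest: symD)
      with max[of "z # xs"] show False by simp
    qed
  qed
  have "\<not> {y \<in> A. (x, y) \<in> R} \<subseteq> {hd ys}"
    using nbr[OF x] card_mono[of "{hd ys}" "{y \<in> A. (x, y) \<in> R}"] by auto
  then obtain z where z: "z \<in> A" "(x, z) \<in> R" "z \<noteq> hd ys" by blast
  with nbrs_on_path obtain us vs where ys: "ys = us @ z # vs"
    by (metis (mono_tags, lifting) mem_Collect_eq split_list subsetD)
  with z have us: "us \<noteq> []" by auto
  let ?zs = "us @ [z, x]"
  have "successively (\<lambda>x y. (x, y) \<in> R) (x # ?zs)"
    using xs z \<open>sym R\<close> us
    by (auto simp: P_def xs_eq ys successively_append_iff successively_Cons dest: symD)
  moreover have "length ?zs \<ge> 3" using us by (cases us) auto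
  moreover have "distinct ?zs" using xs by (auto simp: P_def xs_eq ys)
  ultimately show ?thesis by (intro exI[of _ x] exI[of _ ?zs]) simp
qed

lemma closed_vertex_walk_arcs:
  assumes "successively (\<lambda>x y. (x, y) \<in> R) (x # zs)"
  shows "set (zip (x # zs) zs) \<subseteq> R"
    and "pcas x (zip (x # zs) zs) (last (x # zs))"
    and "pawalk_verts x (zip (x # zs) zs) = x # zs"
  using assms by (induction zs arbitrary: x) auto

lemma undirected_tree_has_leaf:
  assumes "undirected_tree T" "B \<subseteq> pverts T" "B \<noteq> {}"
  shows "\<exists>x\<in>B. deg_in (parcs T) B x \<le> 1"
proof (rule ccontr)
  assume no_leaf: "\<not> ?thesis"
  interpret pair_graph T using assms(1) by (simp add: undirected_tree_def)
  have "sym (parcs T)" by (auto intro: symI arcs_symmetric)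
  moreover have "irrefl (parcs T)" using no_loops' by (auto simp: irrefl_def)
  moreover have "finite B" using assms(2) pair_finite_verts finite_subset by blast
  moreover have "deg_in (parcs T) B x \<ge> 2" if "x \<in> B" for x
    using no_leaf that by force
  ultimately obtain x zs where zs: "length zs \<ge> 3" "distinct zs" "last zs = x"
      "successively (\<lambda>x y. (x, y) \<in> parcs T) (x # zs)"
    using min_degree_two_imp_cycle[of B "parcs T"] \<open>B \<noteq> {}\<close> by blast
  let ?p = "zip (x # zs) zs"
  note arcs = closed_vertex_walk_arcs[OF zs(4)]
  have ne: "zs \<noteq> []" using zs(1) by auto
  have "x \<in> pverts T"
    using zs(4) ne by (cases zs) (auto dest: in_arcsD1)
  then have "cycle ?p"
    using arcs zs ne by (auto simp: cycle_def awalk_def intro!: exI[of _ x])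
  moreover have "length ?p \<ge> 3" using zs(1) by simp
  ultimately show False using assms(1) by (auto simp: undirected_tree_def)
qed

section \<open>Firing orders\<close>

text \<open>
  Each vertex must hold a chip for every neighbour that comes later in the list.  Equivalently,
  the orientation of the edges from earlier to later vertices has out-degrees bounded by \<open>s\<close>.
\<close>

fun firing_order :: "'a rel \<Rightarrow> ('a \<Rightarrow> int) \<Rightarrow> 'a list \<Rightarrow> bool" where
  "firing_order R s [] \<longleftrightarrow> True"
| "firing_order R s (x # xs) \<longleftrightarrow> int (deg_in R (set xs) x) \<le> s x \<and> firing_order R s xs"

text \<open>A new last vertex \<open>l\<close> costs one chip at each of its neighbours, here only \<open>p\<close>.\<close>

lemma firing_order_snoc_leaf:
  assumes "firing_order R (s(p := s p - 1)) w" "l \<notin> set w" "s l \<ge> 0"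
    and "\<And>x. x \<in> set w \<Longrightarrow> (x, l) \<in> R \<Longrightarrow> x = p"
  shows "firing_order R s (w @ [l])"
  using assms
proof (induction w)
  case Nil
  then show ?case by (simp add: deg_in_def)
next
  case (Cons x w)
  then have "firing_order R s (w @ [l])" by simp
  then show ?case using Cons.prems by (auto simp: deg_in_insert split: if_splits)
qed

text \<open>
  Induction on \<open>A\<close>, removing a vertex \<open>x\<close> with at most one neighbour in \<open>A\<close>.  The order may
  start with \<open>x\<close> unless \<open>x\<close> is a leaf without chips.  In that case \<open>x\<close> comes last and its
  neighbour \<open>p\<close> gives up a chip.  The induction hypothesis then applies to the reduced
  configuration: a connected set \<open>C\<close> containing \<open>p\<close> had at least \<open>card C\<close> chips before, since
  \<open>insert x C\<close> is connected as well and \<open>x\<close> contributes nothing.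
\<close>

lemma firing_order_exists:
  fixes s :: "'a \<Rightarrow> int"
  assumes "finite A" "sym R" "irrefl R"
    and "\<And>B. B \<subseteq> A \<Longrightarrow> B \<noteq> {} \<Longrightarrow> \<exists>x\<in>B. deg_in R B x \<le> 1"
    and "\<And>C. C \<subseteq> A \<Longrightarrow> connected_set R C \<Longrightarrow> int (card C) - 1 \<le> sum s C"
  shows "\<exists>w. distinct w \<and> set w = A \<and> firing_order R s w"
  using assms
proof (induction arbitrary: s rule: finite_psubset_induct)
  case (psubset A)
  show ?case
  proof (cases "A = {}")
    case True
    then show ?thesis by (intro exI[of _ "[]"]) simp
  next
    case False
    then obtain x where x: "x \<in> A" "deg_in R A x \<le> 1" using psubset.prems(3)[of A] by blast
    let ?B = "A - {x}"
    have B: "finite ?B" "?B \<subset> A" "x \<notin> ?B" "insert x ?B = A" using psubset.hyps x by auto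
    have "(x, x) \<notin> R" using \<open>irrefl R\<close> by (simp add: irrefl_def)
    then have deg_B: "deg_in R ?B x \<le> 1"
      using deg_in_insert[of ?B x R x] B x by simp
    have IH: "\<exists>w. distinct w \<and> set w = ?B \<and> firing_order R s' w"
      if "\<And>C. C \<subseteq> ?B \<Longrightarrow> connected_set R C \<Longrightarrow> int (card C) - 1 \<le> sum s' C" for s' :: "'a \<Rightarrow> int"
    proof (rule psubset.IH[OF B(2) \<open>sym R\<close> \<open>irrefl R\<close> _ that])
      fix B' assume "B' \<subseteq> ?B" "B' \<noteq> {}"
      then show "\<exists>x\<in>B'. deg_in R B' x \<le> 1" using psubset.prems(3)[of B'] by blast
    qed
    show ?thesis
    proof (cases "int (deg_in R ?B x) \<le> s x")
      case True
      obtain w where "distinct w" "set w = ?B" "firing_order R s w"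
        using IH[of s] psubset.prems(4) by blast
      with True B(4) show ?thesis by (intro exI[of _ "x # w"]) auto
    next
      case False
      have "s x \<ge> 0" using psubset.prems(4)[of "{x}"] x by (simp add: connected_set.singleton)
      with False deg_B have "s x = 0" and "card {y \<in> ?B. (x, y) \<in> R} = 1"
        by (auto simp: deg_in_def)
      then obtain p where p: "{y \<in> ?B. (x, y) \<in> R} = {p}" using card_1_singletonE by blast
      let ?s = "s(p := s p - 1)"
      have "int (card C) - 1 \<le> sum ?s C" if C: "C \<subseteq> ?B" "connected_set R C" for C
      proof (cases "p \<in> C")
        case True
        have fin: "finite C" and "x \<notin> C" using C connected_set_finite by blast+
        have "(p, x) \<in> R" using p \<open>sym R\<close> by (auto dest: symD)
        then have "connected_set R (insert x C)"
          using C True \<open>x \<notin> C\<close> by (auto intro: connected_set.insert)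
        then have "int (card (insert x C)) - 1 \<le> sum s (insert x C)"
          using C x by (intro psubset.prems(4)) auto
        moreover have "sum ?s C = sum s C - 1"
          using sum.remove[OF fin True, of ?s] sum.remove[OF fin True, of s] by simp
        ultimately show ?thesis using fin \<open>x \<notin> C\<close> \<open>s x = 0\<close> by simp
      next
        case False
        then have "sum ?s C = sum s C" by (intro sum.cong) auto
        moreover have "int (card C) - 1 \<le> sum s C" using C by (intro psubset.prems(4)) auto
        ultimately show ?thesis by simp
      qed
      then obtain w where w: "distinct w" "set w = ?B" "firing_order R ?s w"
        using IH[of ?s] by blast
      have "y = p" if "y \<in> set w" "(y, x) \<in> R" for y
      proof -
        have "(x, y) \<in> R" using that(2) \<open>sym R\<close> by (rule symD[rotated])
        then show ?thesis using that w p by blast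
      qed
      then have "firing_order R s (w @ [x])"
        using w \<open>s x = 0\<close> by (intro firing_order_snoc_leaf) auto
      then show ?thesis using w B(4) by (intro exI[of _ "w @ [x]"]) auto
    qed
  qed
qed

section \<open>Connected vertex sets and subtrees\<close>

lemma mk_symmetric_pair_graph:
  assumes "pair_graph H"
  shows "mk_symmetric (with_proj H) = H"
proof -
  interpret pair_graph H by fact
  have "(\<Union>e\<in>parcs H. {(fst e, snd e), (snd e, fst e)}) = parcs H"
    by (auto intro: arcs_symmetric)
  then show ?thesis by (simp add: mk_symmetric_def)
qed

lemma connected_pair_graph_iff:
  assumes "pair_graph H"
  shows "Digraph_Component.connected (with_proj H) \<longleftrightarrow> pverts H \<noteq> {} \<and>
    (\<forall>u\<in>pverts H. \<forall>v\<in>pverts H. (u, v) \<in> rtrancl_on (pverts H) (parcs H))"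
  using mk_symmetric_pair_graph[OF assms]
  by (simp add: connected_def strongly_connected_def reachable_def)

text \<open>If no arc led out of \<open>C\<close>, everything reachable from a vertex of \<open>C\<close> would lie in
  \<open>C\<close>.\<close>

lemma connected_no_cut:
  assumes "pair_graph H" "Digraph_Component.connected (with_proj H)" "C \<subset> pverts H" "C \<noteq> {}"
  shows "\<exists>x\<in>C. \<exists>y\<in>pverts H - C. (x, y) \<in> parcs H"
proof (rule ccontr)
  assume no_exit: "\<not> ?thesis"
  obtain u v where uv: "u \<in> C" "v \<in> pverts H" "v \<notin> C" using assms(3,4) by blast
  then have "(u, v) \<in> rtrancl_on (pverts H) (parcs H)"
    using assms connected_pair_graph_iff by blast
  then have "v \<in> C" using uv(1) no_exit by induction auto
  with uv show False by blast
qed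

lemma subtree_connected_set:
  assumes "subtree H T"
  shows "connected_set (parcs T) (pverts H)"
proof (rule connected_set_if_no_cut)
  have H: "pair_graph H" "Digraph_Component.connected (with_proj H)" "parcs H \<subseteq> parcs T"
    using assms by (auto simp: subtree_def subgraph_def)
  then interpret pair_graph H by simp
  show "finite (pverts H)" by (rule pair_finite_verts)
  show "pverts H \<noteq> {}" using H connected_pair_graph_iff by blast
  show "\<exists>x\<in>C. \<exists>y\<in>pverts H - C. (x, y) \<in> parcs T" if "C \<subset> pverts H" "C \<noteq> {}" for C
    using connected_no_cut[OF H(1,2) that] H(3) by blast
qed

lemma connected_set_rtrancl_on:
  assumes "connected_set R C" "sym R" "u \<in> C" "v \<in> C"
  shows "(u, v) \<in> rtrancl_on C (R \<inter> C \<times> C)"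
  using assms(1,3,4)
proof (induction arbitrary: u v)
  case (singleton x)
  then show ?case by simp
next
  case (insert C x y)
  let ?D = "insert y C"
  let ?S = "R \<inter> ?D \<times> ?D"
  have mono: "(a, b) \<in> rtrancl_on ?D ?S" if "a \<in> C" "b \<in> C" for a b
    using insert.IH[OF that]
  proof (induction rule: rtrancl_on_induct)
    case base
    then show ?case using that by simp
  next
    case (step c d)
    show ?case by (rule rtrancl_on_into_rtrancl_on[OF step.IH]) (use step.hyps in auto)
  qed
  have "(y, x) \<in> R" using insert.hyps \<open>sym R\<close> by (auto dest: symD)
  then have xy: "(x, y) \<in> ?S" "(y, x) \<in> ?S" using insert.hyps by auto
  have x: "(x, x) \<in> rtrancl_on ?D ?S" using insert.hyps by simp
  have "(y, x) \<in> rtrancl_on ?D ?S"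
    by (rule converse_rtrancl_on_into_rtrancl_on[OF xy(2) x]) simp
  then have to_x: "(a, x) \<in> rtrancl_on ?D ?S" if "a \<in> ?D" for a
    using that mono[OF _ insert.hyps(2)] by blast
  have "(x, y) \<in> rtrancl_on ?D ?S"
    by (rule rtrancl_on_into_rtrancl_on[OF x xy(1)]) simp
  then have from_x: "(x, a) \<in> rtrancl_on ?D ?S" if "a \<in> ?D" for a
    using that mono[OF insert.hyps(2)] by blast
  show ?case using rtrancl_on_trans[OF to_x from_x] insert.prems by blast
qed

text \<open>The induced subgraph is a subtree with vertex set \<open>C\<close>, so chip bounds for subtrees give chip
  bounds for connected sets.\<close>

lemma connected_set_subtree:
  assumes "pair_graph T" "connected_set (parcs T) C" "C \<subseteq> pverts T"
  shows "subtree \<lparr>pverts = C, parcs = parcs T \<inter> C \<times> C\<rparr> T"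
proof -
  interpret T: pair_graph T by fact
  let ?H = "\<lparr>pverts = C, parcs = parcs T \<inter> C \<times> C\<rparr>"
  have sym: "sym (parcs T)" by (auto intro: symI T.arcs_symmetric)
  have H: "pair_graph ?H"
    using connected_set_finite[OF assms(2)] T.pair_finite_arcs T.no_loops' sym
    by unfold_locales (auto simp: symmetric_def intro: symI dest: symD)
  then interpret H: pair_graph ?H .
  have "subgraph (with_proj ?H) (with_proj T)"
    using assms(3) T.wf_digraph_axioms H.wf_digraph_axioms
    by (auto simp: subgraph_def compatible_def)
  moreover have "Digraph_Component.connected (with_proj ?H)"
    using connected_pair_graph_iff[OF H] connected_set_nonempty[OF assms(2)]
      connected_set_rtrancl_on[OF assms(2) sym] by simp
  ultimately show ?thesis using H by (simp add: subtree_def)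
qed

section \<open>The effect of firing sequences\<close>

lemma legal_append: "legal G c (u @ v) \<longleftrightarrow> legal G c u \<and> legal G (foldl (fire G) c u) v"
  by (induction u arbitrary: c) auto

context
  fixes n :: nat and T :: "nat pair_pre_digraph"
  assumes graph: "vertex_graph n T"
begin

interpretation pair_graph T
  using graph by (simp add: vertex_graph_def)

lemma card_verts: "card (pverts T) = n"
  using graph by (simp add: vertex_graph_def)

lemma verts_eq: "pverts T = {..<n}"
  using graph by (simp add: vertex_graph_def atLeast0LessThan)

lemma sym_parcs: "sym (parcs T)"
  by (rule symI) (rule arcs_symmetric)

lemma irrefl_parcs: "irrefl (parcs T)"
  unfolding irrefl_def using no_loops' by blast

lemma deg_eq_deg_in: "deg T i = deg_in (parcs T) {..<n} i"
proof -
  have "out_arcs (with_proj T) i = Pair i ` {y \<in> {..<n}. (i, y) \<in> parcs T}"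
    using in_arcsD2 verts_eq by (auto simp: out_arcs_def)
  then show ?thesis by (simp add: out_degree_def deg_in_def card_image inj_on_def)
qed

lemma laplacian_carrier: "laplacian T \<in> carrier_mat n n"
  unfolding laplacian_def card_verts by (rule mat_carrier)

lemma fire_carrier:
  assumes "c \<in> carrier_vec n"
  shows "fire T c i \<in> carrier_vec n"
  unfolding fire_def card_verts
  by (intro minus_carrier_vec[OF assms] mult_mat_vec_carrier[OF laplacian_carrier] unit_vec_carrier)

lemma foldl_fire_carrier: "c \<in> carrier_vec n \<Longrightarrow> foldl (fire T) c w \<in> carrier_vec n"
  by (induction w arbitrary: c) (simp_all add: fire_carrier)

lemma fire_nth:
  assumes "c \<in> carrier_vec n" "i < n" "j < n"
  shows "fire T c i $ j =
    c $ j - (if i = j then int (deg T j) else 0) + (if (j, i) \<in> parcs T then 1 else 0)"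
proof -
  have "(laplacian T *\<^sub>v unit_vec n i) $ j = laplacian T $$ (j, i)"
    using laplacian_carrier assms(2,3) by simp
  also have "\<dots> = (if j = i then int (deg T j) else if (j, i) \<in> parcs T then - 1 else 0)"
    unfolding laplacian_def card_verts using assms(2,3) by (subst index_mat) simp_all
  finally have "fire T c i $ j = c $ j -
      (if j = i then int (deg T j) else if (j, i) \<in> parcs T then - 1 else 0)"
    unfolding fire_def card_verts using laplacian_carrier assms(3) by simp
  then show ?thesis using no_loops'[of j i] by (cases "i = j") auto
qed

lemma sum_fire_outside:
  assumes "c \<in> carrier_vec n" "i < n" "A \<subseteq> {..<n}" "i \<notin> A"
  shows "(\<Sum>j\<in>A. fire T c i $ j) = (\<Sum>j\<in>A. c $ j) + int (deg_in (parcs T) A i)"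
proof -
  have fin: "finite A" using assms(3) finite_subset by blast
  have "(\<Sum>j\<in>A. fire T c i $ j) = (\<Sum>j\<in>A. c $ j + (if (j, i) \<in> parcs T then 1 else 0))"
    using assms by (intro sum.cong) (auto simp: fire_nth)
  also have "\<dots> = (\<Sum>j\<in>A. c $ j) + int (\<Sum>j\<in>A. if (j, i) \<in> parcs T then 1 else 0)"
    by (simp add: sum.distrib) (auto intro!: sum.cong)
  finally show ?thesis using fin by (simp add: deg_in_sum[OF fin sym_parcs])
qed

text \<open>The sum over \<open>w\<close> is the number of chips that enter \<open>A\<close>.  It vanishes if the configuration
  recurs, and then no fired vertex has a neighbour in \<open>A\<close>.\<close>

lemma sum_foldl_fire_outside:
  assumes "c \<in> carrier_vec n" "set w \<subseteq> {..<n}" "A \<subseteq> {..<n}" "set w \<inter> A = {}"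
  shows "(\<Sum>j\<in>A. foldl (fire T) c w $ j) =
    (\<Sum>j\<in>A. c $ j) + int (\<Sum>i\<leftarrow>w. deg_in (parcs T) A i)"
  using assms by (induction w arbitrary: c) (auto simp: fire_carrier sum_fire_outside)

lemma legal_set: "legal T c w \<Longrightarrow> set w \<subseteq> {..<n}"
  by (induction w arbitrary: c) (auto simp: verts_eq)

text \<open>In a connected graph, the set of vertices that do not fire would receive a chip from outside
  and never lose one.\<close>

lemma self_reaching_fires_all:
  assumes conn: "Digraph_Component.connected (with_proj T)"
    and "c \<in> carrier_vec n" "legal T c w" "w \<noteq> []" "foldl (fire T) c w = c"
  shows "set w = {..<n}"
proof (rule ccontr)
  assume "set w \<noteq> {..<n}"
  then have w: "set w \<subset> pverts T" using legal_set assms(3) verts_eq by blast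
  let ?B = "{..<n} - set w"
  obtain x y where xy: "x \<in> set w" "y \<in> ?B" "(x, y) \<in> parcs T"
    using connected_no_cut[OF pair_graph conn w] \<open>w \<noteq> []\<close> verts_eq by auto
  have "(\<Sum>i\<leftarrow>w. deg_in (parcs T) ?B i) = 0"
    using sum_foldl_fire_outside[of c w ?B] assms legal_set by auto
  then have "deg_in (parcs T) ?B x = 0" using xy(1) by (auto simp: sum_list_eq_0_iff)
  then show False using xy by (auto simp: deg_in_def)
qed

text \<open>
  Both sides are doubled in order to count edges by degree sums.  Removing the vertex \<open>x\<close> fired
  last from \<open>A\<close> leaves a set of vertices fired before.  It satisfied the bound then, and the last
  firing adds to it one chip for each edge between \<open>x\<close> and the rest of \<open>A\<close>; if \<open>x\<close> belongs to
  \<open>A\<close>, these are exactly the edges that putting it back creates, and legality keeps the number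
  of chips on \<open>x\<close> nonnegative.
\<close>

lemma legal_chips_ge_edges:
  assumes "c \<in> carrier_vec n" "legal T c w" "A \<subseteq> set w"
  shows "int (\<Sum>x\<in>A. deg_in (parcs T) A x) \<le> 2 * (\<Sum>x\<in>A. foldl (fire T) c w $ x)"
  using assms(2,3)
proof (induction w arbitrary: A rule: rev_induct)
  case Nil
  then show ?case by simp
next
  case (snoc x w)
  let ?c = "foldl (fire T) c w"
  have c: "?c \<in> carrier_vec n" using assms(1) foldl_fire_carrier by blast
  have legal: "legal T c w" "x < n" "?c $ x \<ge> int (deg T x)"
    using snoc.prems by (auto simp: legal_append verts_eq)
  let ?A = "A - {x}"
  have A: "?A \<subseteq> set w" using snoc.prems by auto
  then have fin: "finite ?A" and sub: "?A \<subseteq> {..<n}"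
    using finite_subset[OF A] legal_set[OF legal(1)] by auto
  have IH: "int (\<Sum>y\<in>?A. deg_in (parcs T) ?A y) \<le> 2 * (\<Sum>y\<in>?A. ?c $ y)"
    using snoc.IH[OF legal(1) A] .
  have fire: "(\<Sum>y\<in>?A. fire T ?c x $ y) = (\<Sum>y\<in>?A. ?c $ y) + int (deg_in (parcs T) ?A x)"
    using c legal(2) sub by (intro sum_fire_outside) auto
  show ?case
  proof (cases "x \<in> A")
    case False
    then show ?thesis using IH fire by simp
  next
    case True
    have loop: "(x, x) \<notin> parcs T" using irrefl_parcs by (simp add: irrefl_def)
    then have "fire T ?c x $ x \<ge> 0" using fire_nth[OF c legal(2,2)] legal(3) by simp
    moreover have "insert x ?A = A" using True by auto
    moreover have "(\<Sum>y\<in>insert x ?A. deg_in (parcs T) (insert x ?A) y) =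
        (\<Sum>y\<in>?A. deg_in (parcs T) ?A y) + 2 * deg_in (parcs T) ?A x"
      using fin sym_parcs loop by (intro sum_deg_in_insert) auto
    moreover have "(\<Sum>y\<in>insert x ?A. fire T ?c x $ y) =
        fire T ?c x $ x + (\<Sum>y\<in>?A. fire T ?c x $ y)"
      using fin by (intro sum.insert) auto
    ultimately show ?thesis using IH fire by simp
  qed
qed

lemma foldl_fire_distinct_nth:
  assumes "c \<in> carrier_vec n" "distinct w" "set w \<subseteq> {..<n}" "j < n"
  shows "foldl (fire T) c w $ j =
    c $ j - (if j \<in> set w then int (deg T j) else 0) + int (deg_in (parcs T) (set w) j)"
  using assms(2,3)
proof (induction w rule: rev_induct)
  case Nil
  then show ?case by (simp add: deg_in_def)
next
  case (snoc i w)
  have "foldl (fire T) c w \<in> carrier_vec n" using assms(1) foldl_fire_carrier by blast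
  with snoc assms(4) show ?case by (auto simp: fire_nth deg_in_insert)
qed

text \<open>Before a vertex of \<open>v\<close> fires, it has received one chip from every neighbour fired earlier,
  and the order provides one for each neighbour that is still to fire; together these are all of
  its neighbours.\<close>

lemma firing_order_legal:
  assumes "c \<in> carrier_vec n" "distinct (u @ v)" "set (u @ v) = {..<n}"
    and "firing_order (parcs T) (\<lambda>i. c $ i) v"
  shows "legal T (foldl (fire T) c u) v"
  using assms(2-4)
proof (induction v arbitrary: u)
  case Nil
  then show ?case by simp
next
  case (Cons x v)
  have x: "x < n" using Cons.prems(2) by auto
  have "deg_in (parcs T) {..<n} x =
      deg_in (parcs T) (set u) x + deg_in (parcs T) (insert x (set v)) x"
    using deg_in_disjoint_union[of "set u" "insert x (set v)" "parcs T" x] Cons.prems(1,2) by auto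
  also have "deg_in (parcs T) (insert x (set v)) x = deg_in (parcs T) (set v) x"
    using Cons.prems(1) irrefl_parcs by (simp add: deg_in_insert irrefl_def)
  finally have deg: "deg_in (parcs T) {..<n} x = deg_in (parcs T) (set u) x + deg_in (parcs T) (set v) x" .
  have "set u \<subseteq> {..<n}" using Cons.prems(2) by auto
  then have "foldl (fire T) c u $ x = c $ x + int (deg_in (parcs T) (set u) x)"
    using foldl_fire_distinct_nth[of c u x] assms(1) Cons.prems(1) x by auto
  then have "int (deg T x) \<le> foldl (fire T) c u $ x"
    using deg Cons.prems(3) by (simp add: deg_eq_deg_in)
  moreover have "legal T (foldl (fire T) c (u @ [x])) v"
    using Cons.prems by (intro Cons.IH) auto
  ultimately show ?case using x by (simp add: verts_eq)
qed

text \<open>When all vertices have fired once, each has sent and received as many chips as its degree.\<close>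

lemma firing_order_self_reachable:
  assumes "c \<in> carrier_vec n" "distinct w" "set w = {..<n}"
    and "firing_order (parcs T) (\<lambda>i. c $ i) w"
  shows "self_reachable T c"
proof -
  have "legal T c w" using firing_order_legal[of c "[]" w] assms by simp
  moreover have "0 \<in> set w" using assms(3) graph by (simp add: vertex_graph_def)
  then have "w \<noteq> []" by auto
  moreover have "foldl (fire T) c w = c"
    using assms foldl_fire_carrier[OF assms(1), of w]
    by (intro eq_vecI) (auto simp: foldl_fire_distinct_nth deg_eq_deg_in)
  ultimately show ?thesis
    unfolding self_reachable_def reachable_configs_def mem_Collect_eq by metis
qed

end

section \<open>Self-reachable configurations on trees\<close>

theorem theorem4p1:
  fixes n :: nat and T :: "nat pair_pre_digraph" and s :: "int vec"
  assumes "vertex_graph n T" and "undirected_tree T" and "chip_config T s"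
  shows "self_reachable T s \<longleftrightarrow>
    (\<forall>m H. subtree H T \<and> card (pverts H) = m \<longrightarrow> (\<Sum>i\<in>pverts H. s $ i) \<ge> int m - 1)"
proof -
  note graph = assms(1)
  interpret pair_graph T using graph by (simp add: vertex_graph_def)
  have s: "s \<in> carrier_vec n" using assms(3) card_verts[OF graph] by (simp add: chip_config_def)
  note sym = sym_parcs[OF graph] and irrefl = irrefl_parcs[OF graph]
  show ?thesis
  proof
    assume "self_reachable T s"
    then obtain w where w: "w \<noteq> []" "legal T s w" "foldl (fire T) s w = s"
      unfolding self_reachable_def reachable_configs_def by force
    have fires_all: "set w = {..<n}"
      using assms(2) s w by (intro self_reaching_fires_all[OF graph]) (auto simp: undirected_tree_def)
    show "\<forall>m H. subtree H T \<and> card (pverts H) = m \<longrightarrow> (\<Sum>i\<in>pverts H. s $ i) \<ge> int m - 1"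
    proof (intro allI impI)
      fix m H assume H: "subtree H T \<and> card (pverts H) = m"
      then have "pverts H \<subseteq> set w"
        using verts_eq[OF graph] fires_all by (auto simp: subtree_def subgraph_def)
      then have "int (\<Sum>x\<in>pverts H. deg_in (parcs T) (pverts H) x) \<le> 2 * (\<Sum>x\<in>pverts H. s $ x)"
        using legal_chips_ge_edges[OF graph s w(2)] w(3) by simp
      moreover have "2 * m \<le> (\<Sum>x\<in>pverts H. deg_in (parcs T) (pverts H) x) + 2"
        using connected_set_sum_deg_in[OF subtree_connected_set sym irrefl] H by blast
      ultimately show "(\<Sum>i\<in>pverts H. s $ i) \<ge> int m - 1" by linarith
    qed
  next
    assume chips: "\<forall>m H. subtree H T \<and> card (pverts H) = m \<longrightarrow> (\<Sum>i\<in>pverts H. s $ i) \<ge> int m - 1"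
    have "\<exists>w. distinct w \<and> set w = {..<n} \<and> firing_order (parcs T) (\<lambda>i. s $ i) w"
    proof (rule firing_order_exists[OF _ sym irrefl])
      show "finite {..<n}" by simp
      show "\<exists>x\<in>B. deg_in (parcs T) B x \<le> 1" if "B \<subseteq> {..<n}" "B \<noteq> {}" for B
        using undirected_tree_has_leaf[OF assms(2)] that verts_eq[OF graph] by simp
      show "int (card C) - 1 \<le> (\<Sum>i\<in>C. s $ i)"
        if "C \<subseteq> {..<n}" "connected_set (parcs T) C" for C
      proof -
        have "subtree \<lparr>pverts = C, parcs = parcs T \<inter> C \<times> C\<rparr> T"
          using that verts_eq[OF graph] by (intro connected_set_subtree pair_graph) auto
        with chips show ?thesis by (metis pair_pre_digraph.select_convs(1))
      qed
    qed
    then show "self_reachable T s" using firing_order_self_reachable[OF graph s] by blast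
  qed
qed

end
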